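(* Let $\Psi:\mathcal{K}(\mathbb{R}^n)\to\mathcal{M}(S^{n-1})$ be continuous (with respect to the weak* topology on $\mathcal{M}(S^{n-1})$) and locally determined. Then $\Psi$ is a valuation, i.e. $$\Psi(K\cup L)+\Psi(K\cap L)=\Psi(K)+\Psi(L)$$ for all $K,L\in\mathcal{K}(\mathbb{R}^n)$ such that $K\cup L$ is convex.
   Context: $\mathcal{K}(\mathbb{R}^n)$ is the set of all nonempty compact convex subsets of $\mathbb{R}^n$ with the Hausdorff metric; $h_K(y)=\sup_{x\in K}\langle x,y\rangle$ is the support function. $\mathcal{M}(S^{n-1})\cong C(S^{n-1})'$ is the space of finite complex Borel measures on the unit sphere, with its weak* topology. $\Psi$ is locally determined if for all $K,L\in\mathcal{K}(\mathbb{R}^n)$ and every open $U\subset S^{n-1}$ with $h_K|_U=h_L|_U$ one has $\Psi(K)|_U=\Psi(L)|_U$. *)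

theory Defs
  imports "HOL-Analysis.Analysis" "HOL-Library.Function_Algebras"
begin

section \<open>Convex bodies\<close>

definition convex_bodies :: "'a::euclidean_space set set" where
  "convex_bodies = {K. K \<noteq> {} \<and> compact K \<and> convex K}"

definition support_function :: "'a::euclidean_space set \<Rightarrow> 'a \<Rightarrow> real" where
  "support_function K y = (SUP x\<in>K. x \<bullet> y)"

text \<open>The value 0 outside the convex bodies is only there because the locale
  \<^locale>\<open>Metric_space\<close> asks for nonnegativity of the distance on the whole type.\<close>

definition hausdorff_dist :: "'a::euclidean_space set \<Rightarrow> 'a set \<Rightarrow> real" where
  "hausdorff_dist K L =
    (if K \<in> convex_bodies \<and> L \<in> convex_bodies
     then max (SUP x\<in>K. infdist x L) (SUP y\<in>L. infdist y K) else 0)"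

lemma hausdorff_dist_le_iff:
  assumes "K \<in> convex_bodies" "L \<in> convex_bodies"
  shows "hausdorff_dist K L \<le> r \<longleftrightarrow> (\<forall>x\<in>K. infdist x L \<le> r) \<and> (\<forall>y\<in>L. infdist y K \<le> r)"
proof -
  have "bdd_above ((\<lambda>x. infdist x L) ` K)" if "K \<in> convex_bodies" for K L :: "'a set"
    using that unfolding convex_bodies_def
    by (intro bounded_imp_bdd_above compact_imp_bounded compact_continuous_image)
       (auto intro!: continuous_intros)
  then show ?thesis
    using assms unfolding hausdorff_dist_def
    by (auto simp: cSUP_le_iff convex_bodies_def)
qed

lemma Metric_space_hausdorff_dist: "Metric_space convex_bodies hausdorff_dist"
proof
  fix K L :: "'a set"
  show nn: "0 \<le> hausdorff_dist K L"
  proof (cases "K \<in> convex_bodies \<and> L \<in> convex_bodies")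
    case True
    then obtain x where "x \<in> K" by (auto simp: convex_bodies_def)
    then have "infdist x L \<le> hausdorff_dist K L"
      using True hausdorff_dist_le_iff[of K L "hausdorff_dist K L"] by auto
    then show ?thesis using infdist_nonneg[of x L] by linarith
  qed (auto simp: hausdorff_dist_def)
  show "hausdorff_dist K L = hausdorff_dist L K"
    by (auto simp: hausdorff_dist_def max.commute)
  show "hausdorff_dist K L = 0 \<longleftrightarrow> K = L" if KL: "K \<in> convex_bodies" "L \<in> convex_bodies"
  proof -
    have "hausdorff_dist K L = 0 \<longleftrightarrow> hausdorff_dist K L \<le> 0" using nn by linarith
    also have "\<dots> \<longleftrightarrow> (\<forall>x\<in>K. infdist x L = 0) \<and> (\<forall>y\<in>L. infdist y K = 0)"
      unfolding hausdorff_dist_le_iff[OF KL] using infdist_nonneg by (metis order.antisym order_refl)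
    also have "\<dots> \<longleftrightarrow> K \<subseteq> L \<and> L \<subseteq> K"
      using KL in_closed_iff_infdist_zero[of K] in_closed_iff_infdist_zero[of L]
      by (auto simp: convex_bodies_def compact_imp_closed)
    finally show ?thesis by auto
  qed
next
  fix K L M :: "'a set"
  assume *: "K \<in> convex_bodies" "L \<in> convex_bodies" "M \<in> convex_bodies"
  have tri: "infdist x M \<le> hausdorff_dist K L + hausdorff_dist L M"
    if KLM: "K \<in> convex_bodies" "L \<in> convex_bodies" "M \<in> convex_bodies" and "x \<in> K"
    for K L M :: "'a set" and x
  proof -
    have "closed L" "L \<noteq> {}" using KLM by (auto simp: convex_bodies_def compact_imp_closed)
    then obtain y where y: "y \<in> L" "infdist x L = dist x y"
      using infdist_attains_inf by metis
    have "infdist x M \<le> infdist y M + dist x y" by (rule infdist_triangle)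
    moreover have "infdist y M \<le> hausdorff_dist L M" "infdist x L \<le> hausdorff_dist K L"
      using hausdorff_dist_le_iff[of L M "hausdorff_dist L M"]
        hausdorff_dist_le_iff[of K L "hausdorff_dist K L"] KLM y \<open>x \<in> K\<close> by auto
    ultimately show ?thesis using y by linarith
  qed
  have sym: "hausdorff_dist A B = hausdorff_dist B A" for A B :: "'a set"
    by (auto simp: hausdorff_dist_def max.commute)
  show "hausdorff_dist K M \<le> hausdorff_dist K L + hausdorff_dist L M"
    unfolding hausdorff_dist_le_iff[OF *(1,3)]
    using tri[OF *] tri[OF *(3,2,1)] sym by (metis add.commute)
qed

section \<open>Complex Borel measures on the unit sphere\<close>

definition sphere_borel :: "'a::euclidean_space measure" where
  "sphere_borel = restrict_space borel (sphere 0 1)"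

text \<open>A complex measure is a countably additive complex set function on the Borel sets of the
  sphere (finiteness is automatic).  The library type \<open>measure\<close> only has
  nonnegative measures.  As there, the value on non-Borel sets is 0, so that equality of complex
  measures is equality of functions and their sum is the pointwise sum.\<close>

definition complex_measures :: "('a::euclidean_space set \<Rightarrow> complex) set" where
  "complex_measures =
    {\<mu>. (\<forall>A. A \<notin> sets sphere_borel \<longrightarrow> \<mu> A = 0) \<and>
        (\<forall>A::nat \<Rightarrow> 'a set. range A \<subseteq> sets sphere_borel \<longrightarrow> disjoint_family A \<longrightarrow>
           (\<lambda>i. \<mu> (A i)) sums \<mu> (\<Union>i. A i))}"

text \<open>The positive part in the Jordan decomposition of a real signed measure \<open>\<nu>\<close> is
  \<open>A \<mapsto> sup {\<nu> B | B Borel, B \<subseteq> A}\<close>, its negative part is the positive part of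
  \<open>-\<nu>\<close>.  Negative values are cut off at 0 by \<^const>\<open>ennreal\<close>, which does not change the
  supremum since \<open>\<nu> {} = 0\<close>.\<close>

definition positive_part :: "('a::euclidean_space set \<Rightarrow> real) \<Rightarrow> 'a measure" where
  "positive_part \<nu> = measure_of (sphere 0 1) (sets sphere_borel)
     (\<lambda>A. SUP B\<in>{B \<in> sets sphere_borel. B \<subseteq> A}. ennreal (\<nu> B))"

definition complex_integral ::
    "('a::euclidean_space set \<Rightarrow> complex) \<Rightarrow> ('a \<Rightarrow> complex) \<Rightarrow> complex" where
  "complex_integral \<mu> f =
     (integral\<^sup>L (positive_part (\<lambda>A. Re (\<mu> A))) f - integral\<^sup>L (positive_part (\<lambda>A. - Re (\<mu> A))) f)
     + \<i> * (integral\<^sup>L (positive_part (\<lambda>A. Im (\<mu> A))) f - integral\<^sup>L (positive_part (\<lambda>A. - Im (\<mu> A))) f)"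

text \<open>The coarsest topology for which integration of each continuous function on the sphere is
  continuous.\<close>

definition weak_star_topology :: "('a::euclidean_space set \<Rightarrow> complex) topology" where
  "weak_star_topology = topology_generated_by
     {{\<mu> \<in> complex_measures. complex_integral \<mu> f \<in> V} | f V.
        continuous_on (sphere 0 1) f \<and> open V}"

lemma topspace_weak_star_topology: "topspace weak_star_topology = complex_measures"
proof -
  have "{\<mu> \<in> complex_measures. complex_integral \<mu> (\<lambda>x::'a. 0) \<in> UNIV}
      \<in> {{\<mu> \<in> complex_measures. complex_integral \<mu> f \<in> V} | f V.
           continuous_on (sphere 0 1) f \<and> open V}"
    by (intro CollectI exI[of _ "\<lambda>x::'a. 0"] exI[of _ UNIV]) auto
  then show ?thesis
    unfolding weak_star_topology_def topology_generated_by_topspace by auto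
qed

lemma space_sphere_borel: "space sphere_borel = sphere 0 1"
  by (simp add: sphere_borel_def space_restrict_space)

text \<open>The set function in \<^const>\<open>positive_part\<close> is a measure, so \<^const>\<open>measure_of\<close>
  does not fall back to its default value.\<close>

lemma emeasure_positive_part:
  fixes \<nu> :: "'a::euclidean_space set \<Rightarrow> real"
  assumes sums: "\<And>A::nat \<Rightarrow> 'a set. range A \<subseteq> sets sphere_borel \<Longrightarrow> disjoint_family A \<Longrightarrow>
                  (\<lambda>i. \<nu> (A i)) sums \<nu> (\<Union>i. A i)"
    and A: "A \<in> sets sphere_borel"
  shows "emeasure (positive_part \<nu>) A = (SUP B\<in>{B \<in> sets sphere_borel. B \<subseteq> A}. ennreal (\<nu> B))"
proof -
  define P where "P A = (SUP B\<in>{B \<in> sets sphere_borel. B \<subseteq> A}. ennreal (\<nu> B))" for A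
  have P_upper: "ennreal (\<nu> B) \<le> P A" if "B \<in> sets sphere_borel" "B \<subseteq> A" for A B
    unfolding P_def using that by (intro SUP_upper) auto
  have "(\<lambda>i::nat. \<nu> {}) sums \<nu> {}" using sums[of "\<lambda>_. {}"] by (simp add: disjoint_family_on_def)
  then have "summable (\<lambda>i::nat. \<nu> {})" by (rule sums_summable)
  then have empty: "\<nu> {} = 0" by (simp add: summable_const_iff)
  have add: "\<nu> (B \<union> C) = \<nu> B + \<nu> C"
    if "B \<in> sets sphere_borel" "C \<in> sets sphere_borel" "B \<inter> C = {}" for B C
  proof -
    have "(\<lambda>i. \<nu> (binaryset B C i)) sums \<nu> (\<Union>i. binaryset B C i)"
      using that by (intro sums) (auto simp: range_binaryset_eq disjoint_family_on_def binaryset_def)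
    moreover have "(\<lambda>i. \<nu> (binaryset B C i)) sums (\<nu> B + \<nu> C)"
      using binaryset_sums[where f=\<nu>] empty by auto
    ultimately show ?thesis using sums_unique2 by (metis UN_binaryset_eq)
  qed
  have super: "P A + P C \<le> P (A \<union> C)" if "A \<inter> C = {}" for A C
  proof -
    have ne: "{B \<in> sets sphere_borel. B \<subseteq> A} \<noteq> {}" for A :: "'a set" by auto
    have nonneg_le: "ennreal (\<nu> B) + ennreal (\<nu> D) \<le> P (A \<union> C)"
      if B: "B \<in> sets sphere_borel" "B \<subseteq> A" and D: "D \<in> sets sphere_borel" "D \<subseteq> C" for B D
    proof -
      consider "\<nu> B \<le> 0" | "\<nu> D \<le> 0" | "0 \<le> \<nu> B" "0 \<le> \<nu> D" by linarith
      then show ?thesis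
      proof cases
        case 1 then show ?thesis using P_upper[of D "A \<union> C"] D by (auto simp: ennreal_neg)
      next
        case 2 then show ?thesis using P_upper[of B "A \<union> C"] B by (auto simp: ennreal_neg)
      next
        case 3
        have "\<nu> (B \<union> D) = \<nu> B + \<nu> D" using B D \<open>A \<inter> C = {}\<close> by (intro add) auto
        then show ?thesis using P_upper[of "B \<union> D" "A \<union> C"] B D 3
          by (auto simp: ennreal_plus[symmetric] simp del: ennreal_plus)
      qed
    qed
    have "P A + P C = (SUP D\<in>{B \<in> sets sphere_borel. B \<subseteq> C}.
        SUP B\<in>{B \<in> sets sphere_borel. B \<subseteq> A}. ennreal (\<nu> B) + ennreal (\<nu> D))"
      unfolding P_def using ne
      by (simp add: ennreal_SUP_add_left ennreal_SUP_add_right)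
    also have "\<dots> \<le> P (A \<union> C)" by (intro SUP_least) (use nonneg_le in auto)
    finally show ?thesis .
  qed
  have P_empty: "P {} = 0"
  proof -
    have "{B \<in> sets sphere_borel. B \<subseteq> {}} = {{}::'a set}" by auto
    then show ?thesis by (simp add: P_def empty)
  qed
  have P_mono: "P A \<le> P C" if "A \<subseteq> C" for A C
    unfolding P_def using that by (intro SUP_subset_mono) auto
  have "countably_additive (sets sphere_borel) P"
  proof (intro countably_additiveI antisym)
    fix F :: "nat \<Rightarrow> 'a set"
    assume F: "range F \<subseteq> sets sphere_borel" "disjoint_family F"
    have F_sets: "F i \<in> sets sphere_borel" for i using F(1) by auto
    have fin: "(\<Sum>i<n. P (F i)) \<le> P (\<Union>i<n. F i)" for n
    proof (induction n)
      case (Suc n)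
      have "(\<Union>i<n. F i) \<inter> F n = {}"
      proof -
        have "F i \<inter> F n = {}" if "i < n" for i
          using F(2) that by (auto simp: disjoint_family_on_def)
        then show ?thesis by blast
      qed
      then have "P (\<Union>i<n. F i) + P (F n) \<le> P ((\<Union>i<n. F i) \<union> F n)" by (rule super)
      moreover have "(\<Union>i<n. F i) \<union> F n = (\<Union>i<Suc n. F i)" by (auto simp: less_Suc_eq)
      moreover have "(\<Sum>i<Suc n. P (F i)) \<le> P (\<Union>i<n. F i) + P (F n)"
        using Suc by (simp add: add_right_mono)
      ultimately show ?case by (simp only:)
    qed (simp add: P_empty)
    show "(\<Sum>i. P (F i)) \<le> P (\<Union>i. F i)"
      by (intro suminf_le_const summableI order_trans[OF fin] P_mono) auto
    show "P (\<Union>i. F i) \<le> (\<Sum>i. P (F i))"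
    proof (subst P_def, rule SUP_least)
      fix B assume "B \<in> {B \<in> sets sphere_borel. B \<subseteq> (\<Union>i. F i)}"
      then have B: "B \<in> sets sphere_borel" "(\<Union>i. B \<inter> F i) = B" by auto
      have "range (\<lambda>i. B \<inter> F i) \<subseteq> sets sphere_borel"
        using F_sets B(1) by auto
      moreover have "disjoint_family (\<lambda>i. B \<inter> F i)"
        using F(2) unfolding disjoint_family_on_def by blast
      ultimately have "(\<lambda>i. \<nu> (B \<inter> F i)) sums \<nu> (\<Union>i. B \<inter> F i)" by (rule sums)
      then have s: "(\<lambda>i. \<nu> (B \<inter> F i)) sums \<nu> B" by (simp only: B(2))
      have part: "ennreal (\<Sum>i<n. \<nu> (B \<inter> F i)) \<le> (\<Sum>i. P (F i))" for n
      proof -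
        have "ennreal (\<Sum>i<n. \<nu> (B \<inter> F i)) \<le> ennreal (\<Sum>i<n. max 0 (\<nu> (B \<inter> F i)))"
          by (intro ennreal_leI sum_mono) auto
        also have "\<dots> = (\<Sum>i<n. ennreal (max 0 (\<nu> (B \<inter> F i))))" by (subst sum_ennreal) auto
        also have "\<dots> \<le> (\<Sum>i<n. P (F i))"
        proof (intro sum_mono)
          fix i
          have "ennreal (max 0 (\<nu> (B \<inter> F i))) = ennreal (\<nu> (B \<inter> F i))"
            by (simp add: max_def ennreal_neg)
          also have "\<dots> \<le> P (F i)" using F_sets[of i] B(1) by (intro P_upper) auto
          finally show "ennreal (max 0 (\<nu> (B \<inter> F i))) \<le> P (F i)" .
        qed
        also have "\<dots> \<le> (\<Sum>i. P (F i))" by (intro sum_le_suminf) auto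
        finally show ?thesis .
      qed
      have "(\<lambda>n. ennreal (\<Sum>i<n. \<nu> (B \<inter> F i))) \<longlonglongrightarrow> ennreal (\<nu> B)"
        using s unfolding sums_def by (rule tendsto_ennrealI)
      then show "ennreal (\<nu> B) \<le> (\<Sum>i. P (F i))"
        by (rule LIMSEQ_le_const2) (use part in auto)
    qed
  qed
  then have "emeasure (measure_of (sphere 0 1) (sets sphere_borel) P) A = P A"
    using A P_empty sets.sigma_algebra_axioms[of "sphere_borel :: 'a measure"]
    by (intro emeasure_measure_of_sigma) (auto simp: space_sphere_borel positive_def)
  then show ?thesis by (simp add: positive_part_def P_def[abs_def])
qed

section \<open>Locally determined maps\<close>

definition locally_determined ::
    "('a::euclidean_space set \<Rightarrow> 'a set \<Rightarrow> complex) \<Rightarrow> bool" where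
  "locally_determined \<Psi> \<longleftrightarrow>
    (\<forall>K\<in>convex_bodies. \<forall>L\<in>convex_bodies. \<forall>U.
       openin (top_of_set (sphere 0 1)) U \<longrightarrow>
       (\<forall>u\<in>U. support_function K u = support_function L u) \<longrightarrow>
       (\<forall>A\<in>sets sphere_borel. A \<subseteq> U \<longrightarrow> \<Psi> K A = \<Psi> L A))"

end

theory Submission
  imports Defs
begin

text \<open>Write \<open>A = (K \<inter> L) + r B\<close> for the unit ball \<open>B\<close> and \<open>X' = conv (X \<union> A)\<close> for
  \<open>X = K, L, K \<union> L\<close>.  Since \<open>h\<close> of \<open>K \<inter> L\<close> is \<open>min h\<^sub>K h\<^sub>L\<close>, the support functions of these four
  bodies agree in pairs on each of the three open sets \<open>\<bar>h\<^sub>K - h\<^sub>L\<bar> < r\<close>, \<open>h\<^sub>K > h\<^sub>L\<close> and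
  \<open>h\<^sub>K < h\<^sub>L\<close>, which cover the sphere.  Hence \<open>\<Psi> (K \<union> L)' + \<Psi> A = \<Psi> K' + \<Psi> L'\<close>
  exactly, and \<open>r \<rightarrow> 0\<close> gives the claim because the bodies converge to \<open>K \<union> L\<close>, \<open>K \<inter> L\<close>,
  \<open>K\<close>, \<open>L\<close> and a complex measure is determined by its integrals of continuous functions.\<close>

section \<open>Signed measures and weak* limits\<close>

text \<open>Only values on Borel sets are constrained, so the class contains the real and imaginary
  parts of complex measures and is closed under negation, sums and differences.\<close>

definition signed_measure :: "('a::euclidean_space set \<Rightarrow> real) \<Rightarrow> bool" where
  "signed_measure \<nu> \<longleftrightarrow>
    (\<forall>A::nat \<Rightarrow> 'a set. range A \<subseteq> sets sphere_borel \<longrightarrow> disjoint_family A \<longrightarrow>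
      (\<lambda>i. \<nu> (A i)) sums \<nu> (\<Union>i. A i))"

text \<open>Integration through the Jordan decomposition, as in \<open>complex_integral\<close>.
  Additivity in \<open>\<nu>\<close> is not evident, because positive parts do not add.\<close>

definition signed_integral :: "('a::euclidean_space set \<Rightarrow> real) \<Rightarrow> ('a \<Rightarrow> real) \<Rightarrow> real" where
  "signed_integral \<nu> f =
    integral\<^sup>L (positive_part \<nu>) f - integral\<^sup>L (positive_part (\<lambda>A. - \<nu> A)) f"

section \<open>Elementary properties of signed measures\<close>

lemma signed_measure_sums:
  fixes A :: "nat \<Rightarrow> 'a::euclidean_space set"
  assumes "signed_measure \<nu>" "range A \<subseteq> sets sphere_borel" "disjoint_family A"
  shows "(\<lambda>i. \<nu> (A i)) sums \<nu> (\<Union>i. A i)"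
  using assms unfolding signed_measure_def by blast

lemma signed_measure_uminus: "signed_measure \<nu> \<Longrightarrow> signed_measure (\<lambda>A. - \<nu> A)"
  unfolding signed_measure_def by (auto intro!: sums_minus)

lemma signed_measure_add:
  "signed_measure \<mu> \<Longrightarrow> signed_measure \<nu> \<Longrightarrow> signed_measure (\<lambda>A. \<mu> A + \<nu> A)"
  unfolding signed_measure_def by (auto intro!: sums_add)

lemma signed_measure_diff:
  "signed_measure \<mu> \<Longrightarrow> signed_measure \<nu> \<Longrightarrow> signed_measure (\<lambda>A. \<mu> A - \<nu> A)"
  unfolding signed_measure_def by (auto intro!: sums_diff)

lemma signed_measure_Re: "\<mu> \<in> complex_measures \<Longrightarrow> signed_measure (\<lambda>A. Re (\<mu> A))"
  unfolding signed_measure_def complex_measures_def by (auto intro!: sums_Re)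

lemma signed_measure_Im: "\<mu> \<in> complex_measures \<Longrightarrow> signed_measure (\<lambda>A. Im (\<mu> A))"
  unfolding signed_measure_def complex_measures_def by (auto intro!: sums_Im)

text \<open>A constant series converges only if its terms vanish.\<close>

lemma signed_measure_empty:
  assumes "signed_measure \<nu>" shows "\<nu> {} = 0"
proof -
  have "(\<lambda>i::nat. \<nu> {}) sums \<nu> {}"
    using signed_measure_sums[OF assms, of "\<lambda>_. {}"] by (simp add: disjoint_family_on_def)
  then have "summable (\<lambda>i::nat. \<nu> {})" by (rule sums_summable)
  then show ?thesis by (simp add: summable_const_iff)
qed

lemma signed_measure_Un:
  assumes \<nu>: "signed_measure \<nu>"
    and "B \<in> sets sphere_borel" "C \<in> sets sphere_borel" "B \<inter> C = {}"
  shows "\<nu> (B \<union> C) = \<nu> B + \<nu> C"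
proof -
  have "(\<lambda>i. \<nu> (binaryset B C i)) sums \<nu> (\<Union>i. binaryset B C i)"
    using assms
    by (intro signed_measure_sums) (auto simp: range_binaryset_eq disjoint_family_on_def binaryset_def)
  moreover have "(\<lambda>i. \<nu> (binaryset B C i)) sums (\<nu> B + \<nu> C)"
    using binaryset_sums[where f=\<nu>] signed_measure_empty[OF \<nu>] by auto
  ultimately show ?thesis using sums_unique2 by (metis UN_binaryset_eq)
qed

lemma complex_measure_Un:
  assumes "\<mu> \<in> complex_measures" "B \<in> sets sphere_borel" "C \<in> sets sphere_borel" "B \<inter> C = {}"
  shows "\<mu> (B \<union> C) = \<mu> B + \<mu> C"
  using signed_measure_Un[OF signed_measure_Re assms(2-4)] signed_measure_Un[OF signed_measure_Im assms(2-4)]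
    assms(1) by (simp add: complex_eq_iff)

lemma signed_measure_Diff:
  assumes "signed_measure \<nu>" "A \<in> sets sphere_borel" "B \<in> sets sphere_borel" "B \<subseteq> A"
  shows "\<nu> (A - B) = \<nu> A - \<nu> B"
  using signed_measure_Un[of \<nu> B "A - B"] assms by (simp add: Un_absorb1)

section \<open>The positive part as a finite measure, and the Jordan decomposition\<close>

lemma
  fixes \<nu> :: "'a::euclidean_space set \<Rightarrow> real"
  shows sets_positive_part [simp, measurable_cong]: "sets (positive_part \<nu>) = sets sphere_borel"
    and space_positive_part [simp]: "space (positive_part \<nu>) = sphere 0 1"
  using sets.sigma_sets_eq[of "sphere_borel :: 'a measure"]
    sets.space_closed[of "sphere_borel :: 'a measure"]
  by (simp_all add: positive_part_def space_sphere_borel space_measure_of)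

lemma emeasure_positive_part':
  assumes "signed_measure \<nu>" "A \<in> sets sphere_borel"
  shows "emeasure (positive_part \<nu>) A = (SUP B\<in>{B \<in> sets sphere_borel. B \<subseteq> A}. ennreal (\<nu> B))"
  using assms by (intro emeasure_positive_part) (auto simp: signed_measure_def)

text \<open>If the positive part of \<open>E\<close> is infinite, then \<open>E\<close> splits into two pieces of large absolute
  value, one of which has again infinite positive part.  Iterating yields infinitely many disjoint
  sets with \<open>\<bar>\<nu>\<bar> > 1\<close>, against countable additivity.\<close>

lemma finite_measure_positive_part:
  fixes \<nu> :: "'a::euclidean_space set \<Rightarrow> real"
  assumes \<nu>: "signed_measure \<nu>"
  shows "finite_measure (positive_part \<nu>)"
proof (rule ccontr)
  let ?P = "positive_part \<nu>"
  define Q where "Q E \<longleftrightarrow> E \<in> sets sphere_borel \<and> emeasure ?P E = \<infinity>" for E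
  assume "\<not> ?thesis"
  then have "Q (sphere 0 1)"
    using sets.top[of ?P] finite_measureI[of ?P] by (auto simp: Q_def)
  moreover have "\<exists>E'. Q E' \<and> E' \<subseteq> E \<and> \<bar>\<nu> (E - E')\<bar> > 1" if "Q E" for E
  proof -
    have E: "E \<in> sets sphere_borel" "emeasure ?P E = \<infinity>" using that by (auto simp: Q_def)
    \<comment> \<open>The margin \<open>1 + \<bar>\<nu> E\<bar>\<close> makes both
      \<open>\<nu> B\<close> and \<open>\<bar>\<nu> (E - B)\<bar>\<close> exceed \<open>1\<close>,
      so either piece may be the one that is split off.\<close>
    have "ennreal (1 + \<bar>\<nu> E\<bar>) < emeasure ?P E" using E(2) by simp
    then obtain B where B: "B \<in> sets sphere_borel" "B \<subseteq> E" "ennreal (1 + \<bar>\<nu> E\<bar>) < ennreal (\<nu> B)"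
      unfolding emeasure_positive_part'[OF \<nu> E(1)] less_SUP_iff by blast
    have B1: "\<nu> B > 1 + \<bar>\<nu> E\<bar>" using B(3) by (simp add: ennreal_less_iff del: ennreal_plus)
    have d: "\<nu> (E - B) = \<nu> E - \<nu> B" using signed_measure_Diff[OF \<nu> E(1) B(1,2)] .
    have "emeasure ?P B + emeasure ?P (E - B) = emeasure ?P E"
      using B E by (subst plus_emeasure) (auto simp: Un_absorb1)
    then consider "emeasure ?P B = \<infinity>" | "emeasure ?P (E - B) = \<infinity>" using E(2) by auto
    then show ?thesis
    proof cases
      case 1
      then show ?thesis using B B1 d by (intro exI[of _ B]) (auto simp: Q_def)
    next
      case 2
      have "E - (E - B) = B" using B by auto
      then show ?thesis using 2 B E B1 by (intro exI[of _ "E - B"]) (auto simp: Q_def)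
    qed
  qed
  ultimately obtain E where E: "\<And>n. Q (E n)" "\<And>n. E (Suc n) \<subseteq> E n"
      "\<And>n. \<bar>\<nu> (E n - E (Suc n))\<bar> > 1"
    using dependent_nat_choice[of "\<lambda>_. Q" "\<lambda>_ E E'. E' \<subseteq> E \<and> \<bar>\<nu> (E - E')\<bar> > 1"] by blast
  have dec: "E n \<subseteq> E m" if "m \<le> n" for m n
    using that E(2) by (rule lift_Suc_antimono_le[rotated])
  have "disjoint_family (\<lambda>n. E n - E (Suc n))"
    unfolding disjoint_family_on_def
  proof (intro ballI impI)
    fix m n :: nat assume "m \<noteq> n"
    then have "Suc m \<le> n \<or> Suc n \<le> m" by auto
    then show "(E m - E (Suc m)) \<inter> (E n - E (Suc n)) = {}"
      using dec[of "Suc m" n] dec[of "Suc n" m] by auto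
  qed
  then have "(\<lambda>n. \<nu> (E n - E (Suc n))) sums \<nu> (\<Union>n. E n - E (Suc n))"
    using E(1) by (intro signed_measure_sums[OF \<nu>]) (auto simp: Q_def)
  then have "(\<lambda>n. \<nu> (E n - E (Suc n))) \<longlonglongrightarrow> 0"
    by (intro summable_LIMSEQ_zero sums_summable)
  then have "(\<lambda>n. \<bar>\<nu> (E n - E (Suc n))\<bar>) \<longlonglongrightarrow> 0" by (simp add: tendsto_rabs_zero_iff)
  then have "1 \<le> (0::real)"
    by (rule LIMSEQ_le_const) (use E(3) in \<open>auto intro: less_imp_le\<close>)
  then show False by simp
qed

text \<open>For Borel \<open>B \<subseteq> A\<close>,
  \<open>\<nu> B = \<nu> A - \<nu> (A - B)\<close> is at most \<open>\<nu> A\<close> plus the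
  negative part of \<open>A\<close>. The supremum over \<open>B\<close> gives one inequality, and
  the same for \<open>- \<nu>\<close> gives the other. Finiteness of both parts allows the
  subtraction.\<close>

lemma jordan_decomposition:
  fixes \<nu> :: "'a::euclidean_space set \<Rightarrow> real"
  assumes \<nu>: "signed_measure \<nu>" and A: "A \<in> sets sphere_borel"
  shows "\<nu> A = measure (positive_part \<nu>) A - measure (positive_part (\<lambda>A. - \<nu> A)) A"
proof -
  have le: "measure (positive_part \<nu>) A \<le> \<nu> A + measure (positive_part (\<lambda>A. - \<nu> A)) A"
    if \<nu>: "signed_measure \<nu>" for \<nu> :: "'a set \<Rightarrow> real"
  proof -
    let ?N = "positive_part (\<lambda>A. - \<nu> A)"
    interpret N: finite_measure ?N
      by (intro finite_measure_positive_part signed_measure_uminus \<nu>)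
    interpret P: finite_measure "positive_part \<nu>" by (intro finite_measure_positive_part \<nu>)
    have *: "\<nu> B \<le> \<nu> A + measure ?N A" if B: "B \<in> sets sphere_borel" "B \<subseteq> A" for B
    proof -
      have "ennreal (- \<nu> (A - B)) \<le> emeasure ?N A"
        unfolding emeasure_positive_part'[OF signed_measure_uminus[OF \<nu>] A]
        using A B by (intro SUP_upper) auto
      then have "- \<nu> (A - B) \<le> measure ?N A"
        by (simp add: N.emeasure_eq_measure ennreal_le_iff)
      then show ?thesis using signed_measure_Diff[OF \<nu> A B] by simp
    qed
    have "emeasure (positive_part \<nu>) A \<le> ennreal (\<nu> A + measure ?N A)"
      unfolding emeasure_positive_part'[OF \<nu> A] by (intro SUP_least ennreal_leI) (use * in auto)
    \<comment> \<open>Needed to go back to the reals, as \<open>ennreal\<close> sends negative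
      numbers to 0.\<close>
    moreover have "0 \<le> \<nu> A + measure ?N A" using *[of "{}"] signed_measure_empty[OF \<nu>] by simp
    ultimately show ?thesis by (simp add: P.emeasure_eq_measure)
  qed
  show ?thesis using le[OF \<nu>] le[OF signed_measure_uminus[OF \<nu>]] by simp
qed

section \<open>Integration against signed measures\<close>

lemma integrable_positive_part:
  fixes f :: "'a::euclidean_space \<Rightarrow> real"
  assumes "signed_measure \<nu>" "f \<in> borel_measurable sphere_borel" "\<And>x. norm x = 1 \<Longrightarrow> \<bar>f x\<bar> \<le> C"
  shows "integrable (positive_part \<nu>) f"
proof -
  interpret finite_measure "positive_part \<nu>" by (intro finite_measure_positive_part assms)
  have [measurable]: "f \<in> borel_measurable sphere_borel" by fact
  show ?thesis
    by (rule integrable_const_bound[where B=C]) (use assms(3) in \<open>auto intro!: AE_I2\<close>)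
qed

lemma signed_integral_indicator:
  assumes "signed_measure \<nu>" "A \<in> sets sphere_borel"
  shows "signed_integral \<nu> (indicator A) = \<nu> A"
  using assms jordan_decomposition[OF assms]
    by (simp add: signed_integral_def Int_absorb2 sets.sets_into_space[of A sphere_borel, unfolded space_sphere_borel])

lemma signed_integral_sum_indicator:
  fixes A :: "'i \<Rightarrow> 'a::euclidean_space set"
  assumes \<nu>: "signed_measure \<nu>" and A: "\<And>i. i \<in> I \<Longrightarrow> A i \<in> sets sphere_borel"
  shows "signed_integral \<nu> (\<lambda>x. \<Sum>i\<in>I. c i * indicator (A i) x) = (\<Sum>i\<in>I. c i * \<nu> (A i))"
proof -
  have int: "integrable (positive_part \<mu>) (\<lambda>x. c i * indicator (A i) x)"
    if "signed_measure \<mu>" "i \<in> I" for \<mu> i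
    using that A by (intro integrable_mult_right integrable_positive_part[where C=1])
      (auto simp: indicator_def)
  have "signed_integral \<nu> (\<lambda>x. \<Sum>i\<in>I. c i * indicator (A i) x)
      = (\<Sum>i\<in>I. c i * signed_integral \<nu> (indicator (A i)))"
    using int[OF \<nu>] int[OF signed_measure_uminus[OF \<nu>]]
    by (simp add: signed_integral_def Bochner_Integration.integral_sum right_diff_distrib
        sum_subtractf)
  also have "\<dots> = (\<Sum>i\<in>I. c i * \<nu> (A i))"
    using A \<nu> by (intro sum.cong) (auto simp: signed_integral_indicator)
  finally show ?thesis .
qed

text \<open>Dominated convergence for each Jordan part; the constant bound is integrable because
  both parts are finite.\<close>

lemma signed_integral_tendsto:
  fixes g :: "nat \<Rightarrow> 'a::euclidean_space \<Rightarrow> real"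
  assumes \<nu>: "signed_measure \<nu>" and [measurable]: "f \<in> borel_measurable sphere_borel"
    and [measurable]: "\<And>n. g n \<in> borel_measurable sphere_borel"
    and C: "\<And>n x. norm x = 1 \<Longrightarrow> \<bar>g n x\<bar> \<le> C"
    and lim: "\<And>x. norm x = 1 \<Longrightarrow> (\<lambda>n. g n x) \<longlonglongrightarrow> f x"
  shows "(\<lambda>n. signed_integral \<nu> (g n)) \<longlonglongrightarrow> signed_integral \<nu> f"
proof -
  have "(\<lambda>n. integral\<^sup>L (positive_part \<mu>) (g n)) \<longlonglongrightarrow> integral\<^sup>L (positive_part \<mu>) f"
    if "signed_measure \<mu>" for \<mu>
  proof (rule integral_dominated_convergence[where w="\<lambda>_. C"])
    interpret finite_measure "positive_part \<mu>" by (intro finite_measure_positive_part that)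
    show "integrable (positive_part \<mu>) (\<lambda>_. C)" by simp
  qed (use C lim in auto)
  then show ?thesis
    unfolding signed_integral_def by (intro tendsto_diff) (use \<nu> signed_measure_uminus in auto)
qed

text \<open>Rounding \<open>f\<close> down to multiples of \<open>1 / n\<close> writes the integral as a limit of sums that are
  visibly linear in \<open>\<nu>\<close>, although the positive part is not.\<close>

lemma signed_integral_eq_lim:
  fixes f :: "'a::euclidean_space \<Rightarrow> real" and C :: nat
  assumes \<nu>: "signed_measure \<nu>" and f [measurable]: "f \<in> borel_measurable sphere_borel"
    and C: "\<And>x. norm x = 1 \<Longrightarrow> \<bar>f x\<bar> \<le> real C"
  shows "(\<lambda>n. \<Sum>j\<in>{- int (Suc n * C)..int (Suc n * C)}. real_of_int j / real (Suc n)
            * \<nu> {x \<in> sphere 0 1. \<lfloor>real (Suc n) * f x\<rfloor> = j}) \<longlonglongrightarrow> signed_integral \<nu> f"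
proof -
  \<comment> \<open>Since \<open>\<bar>f x\<bar> \<le> C\<close> on the sphere, the floors lie in
    the finite range \<open>I n\<close>, so \<open>g n\<close> is a simple function there.
    \<open>Suc n\<close> avoids division by zero.\<close>
  define I where "I n = {- int (Suc n * C)..int (Suc n * C)}" for n
  define A where "A n j = {x \<in> sphere 0 1. \<lfloor>real (Suc n) * f x\<rfloor> = j}" for n j
  define g where "g n x = (\<Sum>j\<in>I n. real_of_int j / real (Suc n) * indicator (A n j) x)" for n x
  have A [measurable]: "A n j \<in> sets sphere_borel" for n j
  proof -
    have "{x \<in> space sphere_borel. \<lfloor>real (Suc n) * f x\<rfloor> = j} \<in> sets sphere_borel" by measurable
    then show ?thesis by (simp add: A_def space_sphere_borel)
  qed
  have g: "g n x = real_of_int \<lfloor>real (Suc n) * f x\<rfloor> / real (Suc n)" if x: "norm x = 1" for n x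
  proof -
    have "\<bar>real (Suc n) * f x\<bar> \<le> real (Suc n * C)"
      using mult_left_mono[OF C[OF x], of "real (Suc n)"] by (simp add: abs_mult del: of_nat_Suc mult_Suc)
    then have "- real (Suc n * C) \<le> real (Suc n) * f x" "real (Suc n) * f x \<le> real (Suc n * C)"
      by linarith+
    then have "\<lfloor>real (Suc n) * f x\<rfloor> \<in> I n" unfolding I_def by (auto simp only: atLeastAtMost_iff) linarith+
    moreover have ind: "indicator (A n j) x = (if \<lfloor>real (Suc n) * f x\<rfloor> = j then 1 else (0::real))" for j
      using x by (simp add: A_def indicator_def)
    ultimately show ?thesis
      unfolding g_def ind using finite_atLeastAtMost_int
      by (simp add: I_def if_distrib sum.delta' del: of_nat_Suc mult_Suc cong: if_cong)
  qed
  have close: "\<bar>g n x - f x\<bar> \<le> 1 / real (Suc n)" if x: "norm x = 1" for n x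
  proof -
    have "real_of_int \<lfloor>real (Suc n) * f x\<rfloor> \<le> real (Suc n) * f x"
      "real (Suc n) * f x \<le> real_of_int \<lfloor>real (Suc n) * f x\<rfloor> + 1" by linarith+
    then have "\<bar>real_of_int \<lfloor>real (Suc n) * f x\<rfloor> - real (Suc n) * f x\<bar> / real (Suc n) \<le> 1 / real (Suc n)"
      by (intro divide_right_mono) linarith+
    also have "\<bar>real_of_int \<lfloor>real (Suc n) * f x\<rfloor> - real (Suc n) * f x\<bar> / real (Suc n) = \<bar>g n x - f x\<bar>"
      unfolding g[OF x] by (subst abs_div_pos) (simp_all add: diff_divide_distrib del: of_nat_Suc)
    finally show ?thesis .
  qed
  have "(\<lambda>n. signed_integral \<nu> (g n)) \<longlonglongrightarrow> signed_integral \<nu> f"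
  \<comment> \<open>Rounding moves \<open>f\<close> by at most \<open>1 / Suc n\<close>, hence by at
    most 1, for every \<open>n\<close>.\<close>
  proof (rule signed_integral_tendsto[OF \<nu> f, where C="real C + 1"])
    show "g n \<in> borel_measurable sphere_borel" for n
      unfolding g_def by measurable
    fix x :: 'a assume x: "norm x = 1"
    show "\<bar>g n x\<bar> \<le> real C + 1" for n
    proof -
      have "1 / real (Suc n) \<le> 1" by simp
      then show ?thesis using close[OF x, of n] C[OF x] by linarith
    qed
    have "(\<lambda>n. g n x - f x) \<longlonglongrightarrow> 0"
      by (rule Lim_null_comparison[where g="\<lambda>n. 1 / real (Suc n)"])
        (use close[OF x] LIMSEQ_inverse_real_of_nat in \<open>auto simp: inverse_eq_divide\<close>)
    then show "(\<lambda>n. g n x) \<longlonglongrightarrow> f x" by (rule LIM_zero_cancel)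
  qed
  moreover have "signed_integral \<nu> (g n) = (\<Sum>j\<in>I n. real_of_int j / real (Suc n) * \<nu> (A n j))" for n
    unfolding g_def by (rule signed_integral_sum_indicator[OF \<nu>]) auto
  ultimately show ?thesis by (simp add: I_def A_def)
qed

section \<open>Continuous test functions and the measures they determine\<close>

lemma continuous_on_sphere_measurable:
  "continuous_on (sphere 0 1) f \<Longrightarrow> f \<in> borel_measurable sphere_borel"
  unfolding sphere_borel_def by (rule borel_measurable_continuous_on_restrict)

lemma continuous_on_sphere_bound:
  fixes f :: "'a::euclidean_space \<Rightarrow> real"
  assumes "continuous_on (sphere 0 1) f"
  obtains C :: nat where "\<And>x. norm x = 1 \<Longrightarrow> \<bar>f x\<bar> \<le> real C"
proof -
  have "bounded (f ` sphere 0 1)"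
    using assms by (intro compact_imp_bounded compact_continuous_image) auto
  then obtain B where B: "\<forall>x. norm x = 1 \<longrightarrow> \<bar>f x\<bar> \<le> B" unfolding bounded_iff by fastforce
  obtain C :: nat where "B \<le> real C" using real_arch_simple by blast
  then show ?thesis using B that by (meson order_trans)
qed

text \<open>The approximating sums for all four measures have the same coefficients and level sets,
  so \<open>eq\<close> applies termwise and survives in the limit.\<close>

lemma signed_integral_add_cong:
  fixes f :: "'a::euclidean_space \<Rightarrow> real"
  assumes \<nu>: "signed_measure \<nu>\<^sub>1" "signed_measure \<nu>\<^sub>2" "signed_measure \<nu>\<^sub>3" "signed_measure \<nu>\<^sub>4"
    and eq: "\<And>A. \<nu>\<^sub>1 A + \<nu>\<^sub>2 A = \<nu>\<^sub>3 A + \<nu>\<^sub>4 A" and f: "continuous_on (sphere 0 1) f"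
  shows "signed_integral \<nu>\<^sub>1 f + signed_integral \<nu>\<^sub>2 f = signed_integral \<nu>\<^sub>3 f + signed_integral \<nu>\<^sub>4 f"
proof -
  obtain C :: nat where "\<And>x. norm x = 1 \<Longrightarrow> \<bar>f x\<bar> \<le> real C"
    using continuous_on_sphere_bound[OF f] by blast
  note lim = signed_integral_eq_lim[OF _ continuous_on_sphere_measurable[OF f] this]
  show ?thesis
    using tendsto_add[OF lim[OF \<nu>(1)] lim[OF \<nu>(2)]] tendsto_add[OF lim[OF \<nu>(3)] lim[OF \<nu>(4)]]
    unfolding sum.distrib[symmetric] distrib_left[symmetric] eq by (rule LIMSEQ_unique)
qed

text \<open>Dynkin argument: the closed sets are stable under intersection and generate the Borel
  sets, and vanishing of \<open>\<nu>\<close> passes to complements and countable disjoint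
  unions.\<close>

lemma signed_measure_eq_0:
  fixes \<nu> :: "'a::euclidean_space set \<Rightarrow> real"
  assumes \<nu>: "signed_measure \<nu>" and closed: "\<And>C. closed C \<Longrightarrow> \<nu> (sphere 0 1 \<inter> C) = 0"
    and A: "A \<in> sets sphere_borel"
  shows "\<nu> A = 0"
proof -
  have sub: "sphere 0 1 \<inter> B \<in> sets sphere_borel" if "B \<in> sets borel" for B :: "'a set"
    using that by (auto simp: sphere_borel_def sets_restrict_space)
  obtain B where B: "B \<in> sets borel" "A = sphere 0 1 \<inter> B"
    using A by (auto simp: sphere_borel_def sets_restrict_space)
  have "Int_stable (Collect closed :: 'a set set)" "(Collect closed :: 'a set set) \<subseteq> Pow UNIV"
    by (auto simp: Int_stable_def)
  moreover have "B \<in> sigma_sets UNIV (Collect closed)"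
    using B(1) by (simp add: borel_eq_closed)
  ultimately have "\<nu> (sphere 0 1 \<inter> B) = 0"
  proof (induction rule: sigma_sets_induct_disjoint)
    case (compl B)
    then have "B \<in> sets borel" by (simp add: borel_eq_closed)
    moreover have "sphere 0 1 \<inter> (UNIV - B) = (sphere 0 1 \<inter> UNIV) - (sphere 0 1 \<inter> B)" by auto
    ultimately show ?case
      using signed_measure_Diff[OF \<nu> sub[of UNIV] sub[of B]] closed[of UNIV] compl by simp
  next
    case (union F)
    then have "range F \<subseteq> sets borel" by (simp add: borel_eq_closed)
    then have "(\<lambda>i. \<nu> (sphere 0 1 \<inter> F i)) sums \<nu> (\<Union>i. sphere 0 1 \<inter> F i)"
      using union sub by (intro signed_measure_sums[OF \<nu>]) (auto simp: disjoint_family_on_def)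
    then have "(\<lambda>i. 0) sums \<nu> (sphere 0 1 \<inter> (\<Union>i. F i))"
      using union(3) by (simp only: Int_UN_distrib)
    then show ?case by (metis sums_unique2 sums_zero)
  qed (use closed signed_measure_empty[OF \<nu>] in auto)
  then show ?thesis using B by simp
qed

text \<open>Continuous functions decreasing to the indicator of a closed set recover its measure, so
  the difference of the two sides vanishes on closed sets and hence on all Borel sets.\<close>

lemma signed_measure_eq_0_of_integral:
  fixes \<nu>\<^sub>1 :: "'a::euclidean_space set \<Rightarrow> real"
  assumes \<nu>: "signed_measure \<nu>\<^sub>1" "signed_measure \<nu>\<^sub>2" "signed_measure \<nu>\<^sub>3" "signed_measure \<nu>\<^sub>4"
    and eq: "\<And>f. continuous_on (sphere 0 1) f \<Longrightarrow>
      signed_integral \<nu>\<^sub>1 f + signed_integral \<nu>\<^sub>2 f = signed_integral \<nu>\<^sub>3 f + signed_integral \<nu>\<^sub>4 f"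
    and A: "A \<in> sets sphere_borel"
  shows "\<nu>\<^sub>1 A + \<nu>\<^sub>2 A = \<nu>\<^sub>3 A + \<nu>\<^sub>4 A"
proof -
  let ?\<nu> = "\<lambda>A. \<nu>\<^sub>1 A + \<nu>\<^sub>2 A - (\<nu>\<^sub>3 A + \<nu>\<^sub>4 A)"
  have "?\<nu> A = 0"
  proof (rule signed_measure_eq_0[OF _ _ A])
    show "signed_measure ?\<nu>" by (intro signed_measure_diff signed_measure_add \<nu>)
    fix C :: "'a set" assume C: "closed C"
    let ?C = "sphere 0 1 \<inter> C"
    have C': "?C \<in> sets sphere_borel"
      using C by (auto simp: sphere_borel_def sets_restrict_space)
    show "?\<nu> ?C = 0"
    \<comment> \<open>The empty set is treated apart because \<open>infdist x {} = 0\<close> would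
      make every \<open>g n\<close> constantly 1.\<close>
    proof (cases "C = {}")
      case True
      then show ?thesis using \<nu> by (simp add: signed_measure_empty)
    next
      case False
      define g where "g n x = max 0 (1 - real n * infdist x C)" for n x
      have g: "continuous_on (sphere 0 1) (g n)" for n
        unfolding g_def by (intro continuous_intros)
      have lim: "(\<lambda>n. signed_integral \<mu> (g n)) \<longlonglongrightarrow> \<mu> ?C" if "signed_measure \<mu>" for \<mu>
      proof -
        have "(\<lambda>n. signed_integral \<mu> (g n)) \<longlonglongrightarrow> signed_integral \<mu> (indicator ?C)"
        proof (rule signed_integral_tendsto[OF that, where C=1])
          show "g n \<in> borel_measurable sphere_borel" for n
            by (rule continuous_on_sphere_measurable[OF g])
          show "\<bar>g n x\<bar> \<le> 1" for n x
            by (auto simp: g_def infdist_nonneg)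
          fix x :: 'a assume x: "norm x = 1"
          show "(\<lambda>n. g n x) \<longlonglongrightarrow> indicator ?C x"
          proof (cases "x \<in> C")
            case True
            then show ?thesis using x by (simp add: g_def)
          next
            case nC: False
            then have pos: "infdist x C > 0"
              using C False infdist_pos_not_in_closed by blast
            \<comment> \<open>From this index on the cut-off at 0 is active, so \<open>g n x\<close>
              is exactly 0.\<close>
            then obtain N :: nat where N: "1 < real N * infdist x C"
              using reals_Archimedean3 by blast
            have "\<forall>\<^sub>F n in sequentially. g n x = indicator ?C x"
              using eventually_ge_at_top[of N]
            proof eventually_elim
              case (elim n)
              then have "real N * infdist x C \<le> real n * infdist x C"
                using pos by (intro mult_right_mono) auto
              then show ?case using N nC by (simp add: g_def)
            qed
            then show ?thesis by (rule tendsto_eventually)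
          qed
        qed (use C' in auto)
        then show ?thesis by (simp add: signed_integral_indicator[OF that C'])
      qed
      show ?thesis
        using LIMSEQ_unique[OF tendsto_add[OF lim[OF \<nu>(1)] lim[OF \<nu>(2)]]]
          tendsto_add[OF lim[OF \<nu>(3)] lim[OF \<nu>(4)]] eq[OF g] by simp
    qed
  qed
  then show ?thesis by simp
qed

section \<open>Passage to complex measures and weak* limits\<close>

lemma complex_integral_of_real:
  "complex_integral \<mu> (\<lambda>x. complex_of_real (f x)) =
    Complex (signed_integral (\<lambda>A. Re (\<mu> A)) f) (signed_integral (\<lambda>A. Im (\<mu> A)) f)"
  by (simp add: complex_integral_def signed_integral_def complex_eq_iff)

text \<open>The preimage of an open set under integration of \<open>f\<close> is one of the sets
  generating the topology.\<close>

lemma weak_star_limit_integral: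
  assumes lim: "limitin weak_star_topology \<mu> m F" and f: "continuous_on (sphere 0 1) f"
  shows "((\<lambda>n. complex_integral (\<mu> n) f) \<longlongrightarrow> complex_integral m f) F"
proof (rule topological_tendstoI)
  fix V :: "complex set" assume V: "open V" "complex_integral m f \<in> V"
  let ?W = "{\<mu> \<in> complex_measures. complex_integral \<mu> f \<in> V}"
  have "openin weak_star_topology ?W"
    unfolding weak_star_topology_def by (rule topology_generated_by_Basis) (use f V in blast)
  moreover have "m \<in> ?W"
    using V limitin_topspace[OF lim] by (simp add: topspace_weak_star_topology)
  ultimately have "\<forall>\<^sub>F n in F. \<mu> n \<in> ?W" using lim unfolding limitin_def by blast
  then show "\<forall>\<^sub>F n in F. complex_integral (\<mu> n) f \<in> V" by (rule eventually_mono) simp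
qed

text \<open>Tested against real continuous functions, the identity for each \<open>n\<close> becomes
  one of integrals, which passes to the limit. Such integrals determine real and imaginary parts
  separately.\<close>

lemma weak_star_limit_add_cong:
  fixes \<mu>\<^sub>1 :: "nat \<Rightarrow> ('a::euclidean_space set \<Rightarrow> complex)"
  assumes lim: "limitin weak_star_topology \<mu>\<^sub>1 m\<^sub>1 sequentially" "limitin weak_star_topology \<mu>\<^sub>2 m\<^sub>2 sequentially"
      "limitin weak_star_topology \<mu>\<^sub>3 m\<^sub>3 sequentially" "limitin weak_star_topology \<mu>\<^sub>4 m\<^sub>4 sequentially"
    and cm: "\<And>n. \<mu>\<^sub>1 n \<in> complex_measures" "\<And>n. \<mu>\<^sub>2 n \<in> complex_measures"
      "\<And>n. \<mu>\<^sub>3 n \<in> complex_measures" "\<And>n. \<mu>\<^sub>4 n \<in> complex_measures"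
    and eq: "\<And>n. \<mu>\<^sub>1 n + \<mu>\<^sub>2 n = \<mu>\<^sub>3 n + \<mu>\<^sub>4 n"
  shows "m\<^sub>1 + m\<^sub>2 = m\<^sub>3 + m\<^sub>4"
proof
  fix A :: "'a set"
  have m: "m\<^sub>1 \<in> complex_measures" "m\<^sub>2 \<in> complex_measures" "m\<^sub>3 \<in> complex_measures" "m\<^sub>4 \<in> complex_measures"
    using lim[THEN limitin_topspace] by (auto simp: topspace_weak_star_topology)
  have eq': "\<mu>\<^sub>1 n A + \<mu>\<^sub>2 n A = \<mu>\<^sub>3 n A + \<mu>\<^sub>4 n A" for n A
    using fun_cong[OF eq[of n], of A] by simp
  have eqs: "complex_integral m\<^sub>1 (\<lambda>x. complex_of_real (f x)) + complex_integral m\<^sub>2 (\<lambda>x. complex_of_real (f x))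
      = complex_integral m\<^sub>3 (\<lambda>x. complex_of_real (f x)) + complex_integral m\<^sub>4 (\<lambda>x. complex_of_real (f x))"
    if f: "continuous_on (sphere 0 1) f" for f
  proof -
    let ?f = "\<lambda>x. complex_of_real (f x)"
    have f': "continuous_on (sphere 0 1) ?f" by (intro continuous_intros f)
    have "complex_integral (\<mu>\<^sub>1 n) ?f + complex_integral (\<mu>\<^sub>2 n) ?f
        = complex_integral (\<mu>\<^sub>3 n) ?f + complex_integral (\<mu>\<^sub>4 n) ?f" for n
      using signed_integral_add_cong[OF cm[THEN signed_measure_Re] _ f, of n n n n]
        signed_integral_add_cong[OF cm[THEN signed_measure_Im] _ f, of n n n n] eq'[of n]
      by (simp add: complex_integral_of_real complex_eq_iff)
    moreover note l = lim[THEN weak_star_limit_integral, rotated -1, OF f']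
    ultimately show ?thesis
      using LIMSEQ_unique[OF tendsto_add[OF l(1,2)]] tendsto_add[OF l(3,4)] by simp
  qed
  show "(m\<^sub>1 + m\<^sub>2) A = (m\<^sub>3 + m\<^sub>4) A"
  proof (cases "A \<in> sets sphere_borel")
    case True
    have "Re (m\<^sub>1 A) + Re (m\<^sub>2 A) = Re (m\<^sub>3 A) + Re (m\<^sub>4 A)"
      by (rule signed_measure_eq_0_of_integral[OF m[THEN signed_measure_Re] _ True])
        (use eqs in \<open>simp add: complex_integral_of_real complex_eq_iff\<close>)
    moreover have "Im (m\<^sub>1 A) + Im (m\<^sub>2 A) = Im (m\<^sub>3 A) + Im (m\<^sub>4 A)"
      by (rule signed_measure_eq_0_of_integral[OF m[THEN signed_measure_Im] _ True])
        (use eqs in \<open>simp add: complex_integral_of_real complex_eq_iff\<close>)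
    ultimately show ?thesis by (simp add: complex_eq_iff)
  next
    \<comment> \<open>Off the Borel sets every complex measure is 0 by convention.\<close>
    case False
    then show ?thesis using m by (simp add: complex_measures_def)
  qed
qed

section \<open>Support functions\<close>

text \<open>Ensures that the conditional supremum in \<open>support_function\<close> is a true
  supremum.\<close>

lemma bdd_above_support: "K \<in> convex_bodies \<Longrightarrow> bdd_above ((\<lambda>x. x \<bullet> y) ` K)"
  unfolding convex_bodies_def
  by (intro bounded_imp_bdd_above compact_imp_bounded compact_continuous_image)
     (auto intro!: continuous_intros)

lemma support_function_le_iff:
  "K \<in> convex_bodies \<Longrightarrow> support_function K y \<le> c \<longleftrightarrow> (\<forall>x\<in>K. x \<bullet> y \<le> c)"
  unfolding support_function_def
  by (subst cSUP_le_iff) (auto simp: convex_bodies_def intro: bdd_above_support[unfolded convex_bodies_def])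

lemma support_function_ge: "K \<in> convex_bodies \<Longrightarrow> x \<in> K \<Longrightarrow> x \<bullet> y \<le> support_function K y"
  using support_function_le_iff[of K y "support_function K y"] by auto

lemma support_function_attained:
  assumes "K \<in> convex_bodies"
  obtains x where "x \<in> K" "x \<bullet> y = support_function K y"
proof -
  have "continuous_on K (\<lambda>x. x \<bullet> y)" by (intro continuous_intros)
  then obtain x where "x \<in> K" "\<forall>z\<in>K. z \<bullet> y \<le> x \<bullet> y"
    using continuous_attains_sup[of K "\<lambda>x. x \<bullet> y"] assms by (auto simp: convex_bodies_def)
  then show ?thesis
    using that support_function_le_iff[OF assms, of y "x \<bullet> y"] support_function_ge[OF assms]
    by (metis order_antisym)
qed

lemma convex_hull_Un_convex_bodies:
  "K \<in> convex_bodies \<Longrightarrow> L \<in> convex_bodies \<Longrightarrow> convex hull (K \<union> L) \<in> convex_bodies"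
  by (auto simp: convex_bodies_def compact_convex_hull compact_Un)

text \<open>A half-space is convex, so it contains the hull iff it contains \<open>K\<close> and
  \<open>L\<close>; both sides thus have the same upper bounds.\<close>

lemma support_function_convex_hull_Un:
  assumes "K \<in> convex_bodies" "L \<in> convex_bodies"
  shows "support_function (convex hull (K \<union> L)) y = max (support_function K y) (support_function L y)"
proof -
  have "support_function (convex hull (K \<union> L)) y \<le> c \<longleftrightarrow>
      max (support_function K y) (support_function L y) \<le> c" for c
  proof -
    have "convex hull (K \<union> L) \<subseteq> {x. x \<bullet> y \<le> c} \<longleftrightarrow> K \<union> L \<subseteq> {x. x \<bullet> y \<le> c}"
      using hull_minimal[of "K \<union> L" "{x. x \<bullet> y \<le> c}" convex] hull_subset[of "K \<union> L" convex]
      by (auto simp: inner_commute[of _ y] convex_halfspace_le)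
    then show ?thesis
      unfolding support_function_le_iff[OF convex_hull_Un_convex_bodies[OF assms]] max.bounded_iff
        support_function_le_iff[OF assms(1)] support_function_le_iff[OF assms(2)]
      by blast
  qed
  then show ?thesis by (metis order_antisym order_refl)
qed

text \<open>The segment is connected and covered by two closed sets that both meet it.\<close>

lemma convex_Un_segment_meets:
  fixes K L :: "'a::euclidean_space set"
  assumes "closed K" "closed L" "convex (K \<union> L)" "x \<in> K" "y \<in> L"
  shows "\<exists>z\<in>K \<inter> L. z \<in> closed_segment x y"
proof (rule ccontr)
  assume "\<not> ?thesis"
  moreover have "closed_segment x y \<subseteq> K \<union> L"
    using assms by (intro closed_segment_subset) auto
  ultimately show False
    using connected_segment[of x y] assms unfolding connected_closed by blast
qed

text \<open>Convexity of the union serves to make the intersection nonempty.\<close>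

lemma Int_convex_bodies:
  assumes "K \<in> convex_bodies" "L \<in> convex_bodies" "convex (K \<union> L)"
  shows "K \<inter> L \<in> convex_bodies"
proof -
  obtain x y where "x \<in> K" "y \<in> L" using assms by (auto simp: convex_bodies_def)
  then show ?thesis
    using assms convex_Un_segment_meets[of K L x y]
    by (auto simp: convex_bodies_def compact_imp_closed convex_Int compact_Int)
qed

text \<open>Join a maximizer in \<open>K\<close> to one in \<open>L\<close>. The segment meets
  \<open>K \<inter> L\<close>, and it stays in the half-space where the inner product with
  \<open>u\<close> is at least the smaller of the two maxima.\<close>

lemma support_function_Int:
  assumes K: "K \<in> convex_bodies" and L: "L \<in> convex_bodies" and "convex (K \<union> L)"
  shows "support_function (K \<inter> L) u = min (support_function K u) (support_function L u)"
proof (rule antisym)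
  note KL = Int_convex_bodies[OF assms]
  show "support_function (K \<inter> L) u \<le> min (support_function K u) (support_function L u)"
    unfolding support_function_le_iff[OF KL] using support_function_ge[OF K] support_function_ge[OF L] by auto
  obtain x where x: "x \<in> K" "x \<bullet> u = support_function K u" by (rule support_function_attained[OF K])
  obtain y where y: "y \<in> L" "y \<bullet> u = support_function L u" by (rule support_function_attained[OF L])
  obtain z where z: "z \<in> K \<inter> L" "z \<in> closed_segment x y"
    using convex_Un_segment_meets[of K L x y] assms x y
    by (auto simp: convex_bodies_def compact_imp_closed)
  have "closed_segment x y \<subseteq> {w. u \<bullet> w \<ge> min (support_function K u) (support_function L u)}"
    using x y by (intro closed_segment_subset convex_halfspace_ge) (auto simp: inner_commute)
  then show "min (support_function K u) (support_function L u) \<le> support_function (K \<inter> L) u"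
    using z support_function_ge[OF KL z(1), of u] by (auto simp: inner_commute)
qed

section \<open>Parallel bodies: Minkowski sums with balls\<close>

definition parallel_body :: "'a::euclidean_space set \<Rightarrow> real \<Rightarrow> 'a set" where
  "parallel_body K r = (\<Union>x\<in>K. \<Union>y\<in>cball 0 r. {x + y})"

lemma parallel_body_superset: "0 \<le> r \<Longrightarrow> K \<subseteq> parallel_body K r"
  unfolding parallel_body_def by force

lemma parallel_body_mono: "K \<subseteq> L \<Longrightarrow> parallel_body K r \<subseteq> parallel_body L r"
  unfolding parallel_body_def by auto

lemma parallel_body_convex_bodies:
  assumes "K \<in> convex_bodies" "0 \<le> r" shows "parallel_body K r \<in> convex_bodies"
proof -
  have "parallel_body K r \<noteq> {}"
    using assms parallel_body_superset[of r K] by (auto simp: convex_bodies_def)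
  moreover have "compact (parallel_body K r)" "convex (parallel_body K r)"
    using assms convex_sums[of K "cball 0 r"] compact_sums'[of K "cball 0 r"]
    by (auto simp: parallel_body_def convex_bodies_def)
  ultimately show ?thesis by (simp add: convex_bodies_def)
qed

text \<open>On the ball of radius \<open>r\<close> the functional given by the unit vector
  \<open>u\<close> has maximum \<open>r\<close>, by Cauchy-Schwarz, attained at
  \<open>r *\<^sub>R u\<close>.\<close>

lemma support_function_parallel_body:
  assumes K: "K \<in> convex_bodies" and r: "0 \<le> r" and u: "norm u = 1"
  shows "support_function (parallel_body K r) u = support_function K u + r"
proof (rule antisym)
  note Kr = parallel_body_convex_bodies[OF K r]
  have "(x + y) \<bullet> u \<le> support_function K u + r" if "x \<in> K" "norm y \<le> r" for x y
    using support_function_ge[OF K that(1), of u] norm_cauchy_schwarz[of y u] that(2) u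
    by (simp add: inner_add_left)
  then show "support_function (parallel_body K r) u \<le> support_function K u + r"
    unfolding support_function_le_iff[OF Kr] by (auto simp: parallel_body_def)
  obtain x where x: "x \<in> K" "x \<bullet> u = support_function K u" by (rule support_function_attained[OF K])
  have "x + r *\<^sub>R u \<in> parallel_body K r" using x r u by (force simp: parallel_body_def)
  then show "support_function K u + r \<le> support_function (parallel_body K r) u"
    using support_function_ge[OF Kr, of "x + r *\<^sub>R u" u] x u
    by (simp add: inner_add_left dot_square_norm)
qed

text \<open>A norm bound for the points of \<open>K\<close> is a Lipschitz constant.\<close>

lemma continuous_on_support_function:
  assumes K: "K \<in> convex_bodies" shows "continuous_on S (support_function K)"
proof -
  obtain R where R: "0 < R" "\<forall>x\<in>K. norm x \<le> R"
    using K bounded_pos[of K] by (auto simp: convex_bodies_def compact_imp_bounded)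
  have le: "support_function K u \<le> support_function K v + R * dist u v" for u v
    unfolding support_function_le_iff[OF K]
  proof
    fix x assume x: "x \<in> K"
    have "x \<bullet> u = x \<bullet> v + x \<bullet> (u - v)" by (simp add: inner_diff_right)
    also have "\<dots> \<le> support_function K v + norm x * norm (u - v)"
      by (intro add_mono support_function_ge K x norm_cauchy_schwarz)
    also have "\<dots> \<le> support_function K v + R * dist u v"
      using R x by (auto simp: dist_norm intro!: mult_right_mono)
    finally show "x \<bullet> u \<le> support_function K v + R * dist u v" .
  qed
  have "R-lipschitz_on S (support_function K)"
  proof (rule lipschitz_onI)
    show "dist (support_function K u) (support_function K v) \<le> R * dist u v" for u v
      using le[of u v] le[of v u] by (auto simp: dist_real_def dist_commute abs_le_iff)
  qed (use R in auto)
  then show ?thesis by (rule lipschitz_on_continuous_on)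
qed

lemma hausdorff_dist_le_parallel_body:
  assumes "K \<in> convex_bodies" "L \<in> convex_bodies" "K \<subseteq> L" "L \<subseteq> parallel_body K r" "0 \<le> r"
  shows "hausdorff_dist L K \<le> r"
  unfolding hausdorff_dist_le_iff[OF assms(2,1)]
proof (intro conjI ballI)
  fix z assume "z \<in> L"
  then obtain x y where "x \<in> K" "norm y \<le> r" "z = x + y"
    using assms(4) by (auto simp: parallel_body_def)
  then show "infdist z K \<le> r" by (intro infdist_le2[of x]) (auto simp: dist_norm)
next
  fix z assume "z \<in> K"
  then show "infdist z L \<le> r" using assms by auto
qed

text \<open>Supplies the convergence of all the approximating bodies in the final limit.\<close>

lemma limitin_parallel_body_squeeze:
  assumes K: "K \<in> convex_bodies"
    and "\<And>n. L n \<in> convex_bodies" "\<And>n. K \<subseteq> L n" "\<And>n. L n \<subseteq> parallel_body K (r n)"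
    and "\<And>n. 0 \<le> r n" "r \<longlonglongrightarrow> 0"
  shows "limitin (Metric_space.mtopology convex_bodies hausdorff_dist) L K sequentially"
proof -
  interpret Metric_space convex_bodies "hausdorff_dist :: 'a::euclidean_space set \<Rightarrow> _"
    by (rule Metric_space_hausdorff_dist)
  have "hausdorff_dist (L n) K \<le> r n" for n
    using assms by (intro hausdorff_dist_le_parallel_body)
  then have "(\<lambda>n. hausdorff_dist (L n) K) \<longlonglongrightarrow> 0"
    using nonneg by (intro tendsto_sandwich[OF _ _ tendsto_const assms(6)]) auto
  then show ?thesis using assms by (simp add: limitin_metric_dist_null)
qed

text \<open>Locality needs open sets, while the set where the support functions of \<open>K\<close>
  and \<open>L\<close> agree is only closed. Enlarging the intersection by \<open>r\<close> makes
  all four bodies share a support function on an open neighbourhood of that set.\<close>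

lemma locally_determined_perturbed_valuation:
  fixes \<Psi> :: "'a::euclidean_space set \<Rightarrow> ('a set \<Rightarrow> complex)"
  assumes \<Psi>: "locally_determined \<Psi>" and cm: "\<And>K. K \<in> convex_bodies \<Longrightarrow> \<Psi> K \<in> complex_measures"
    and K: "K \<in> convex_bodies" and L: "L \<in> convex_bodies" and KL: "convex (K \<union> L)" and r: "0 < r"
  defines "A \<equiv> parallel_body (K \<inter> L) r"
  shows "\<Psi> (convex hull (K \<union> L \<union> A)) + \<Psi> A = \<Psi> (convex hull (K \<union> A)) + \<Psi> (convex hull (L \<union> A))"
proof
  let ?h = support_function
  have M: "K \<union> L \<in> convex_bodies" using K L KL by (auto simp: convex_bodies_def)
  note I = Int_convex_bodies[OF K L KL]
  have A: "A \<in> convex_bodies" unfolding A_def by (rule parallel_body_convex_bodies) (use I r in auto)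
  note bodies = A convex_hull_Un_convex_bodies[OF K A] convex_hull_Un_convex_bodies[OF L A]
    convex_hull_Un_convex_bodies[OF M A]
  have hA: "?h A u = min (?h K u) (?h L u) + r" if "norm u = 1" for u
    using support_function_parallel_body[OF I _ that] r support_function_Int[OF K L KL]
    by (simp add: A_def)
  have hM: "?h (K \<union> L) u = max (?h K u) (?h L u)" for u
    using support_function_convex_hull_Un[OF K L] KL by (simp add: hull_same)
  note h = support_function_convex_hull_Un[OF K A] support_function_convex_hull_Un[OF L A]
    support_function_convex_hull_Un[OF M A] hM
  have eq: "\<Psi> X B = \<Psi> Y B"
    if "X \<in> convex_bodies" "Y \<in> convex_bodies" "openin (top_of_set (sphere 0 1)) U"
      "\<And>u. u \<in> U \<Longrightarrow> ?h X u = ?h Y u" "B \<in> sets sphere_borel" "B \<subseteq> U" for X Y U B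
    using \<Psi>[unfolded locally_determined_def, rule_format, OF that] .
  define d where "d u = ?h K u - ?h L u" for u
  have d: "continuous_on (sphere 0 1) d"
    unfolding d_def by (intro continuous_intros continuous_on_support_function K L)
  define U where "U V = sphere 0 1 \<inter> d -` V" for V
  have U: "openin (top_of_set (sphere 0 1)) (U V)" if "open V" for V
    unfolding U_def by (rule continuous_openin_preimage_gen[OF d that])
  have U_sets: "U V \<in> sets sphere_borel" if V: "open V" for V
  proof -
    obtain T where "open T" "U V = sphere 0 1 \<inter> T" using U[OF V] unfolding openin_open by blast
    then show ?thesis unfolding sphere_borel_def sets_restrict_space by (intro image_eqI) auto
  qed
  let ?MA = "convex hull (K \<union> L \<union> A)" and ?KA = "convex hull (K \<union> A)" and ?LA = "convex hull (L \<union> A)"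
  have supp: "?h ?MA u = ?h A u" "?h ?KA u = ?h A u" "?h ?LA u = ?h A u" if "u \<in> U {-r<..<r}" for u
  proof -
    \<comment> \<open>This bound says that the larger of the two values is below the smaller plus
      \<open>r\<close>, which is \<open>?h A u\<close>.\<close>
    have u: "norm u = 1" "\<bar>?h K u - ?h L u\<bar> < r" using that by (auto simp: U_def d_def)
    then have "?h K u \<le> ?h A u" "?h L u \<le> ?h A u" using r by (auto simp: hA min_def)
    then show "?h ?MA u = ?h A u" "?h ?KA u = ?h A u" "?h ?LA u = ?h A u" by (simp_all add: h)
  qed
  have supp_pos: "?h ?MA u = ?h ?KA u" "?h ?LA u = ?h A u" if "u \<in> U {0<..}" for u
  proof -
    have u: "norm u = 1" "?h L u < ?h K u" using that by (auto simp: U_def d_def)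
    \<comment> \<open>Here \<open>L\<close> has the smaller value, so \<open>A\<close> dominates it,
      and \<open>L\<close> drops out of both maxima.\<close>
    then have "?h L u \<le> ?h A u" using r by (simp add: hA)
    then show "?h ?MA u = ?h ?KA u" "?h ?LA u = ?h A u" using u(2) by (simp_all add: h)
  qed
  have supp_neg: "?h ?MA u = ?h ?LA u" "?h ?KA u = ?h A u" if "u \<in> U {..<0}" for u
  proof -
    have u: "norm u = 1" "?h K u < ?h L u" using that by (auto simp: U_def d_def)
    then have "?h K u \<le> ?h A u" using r by (simp add: hA)
    then show "?h ?MA u = ?h ?LA u" "?h ?KA u = ?h A u" using u(2) by (simp_all add: h)
  qed
  have eq1: "\<Psi> ?MA B + \<Psi> A B = \<Psi> ?KA B + \<Psi> ?LA B"
    if B: "B \<in> sets sphere_borel" "B \<subseteq> U {-r<..<r}" for B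
    using eq[OF bodies(4,1) U supp(1) B] eq[OF bodies(2,1) U supp(2) B] eq[OF bodies(3,1) U supp(3) B]
    by simp
  have eq2: "\<Psi> ?MA B + \<Psi> A B = \<Psi> ?KA B + \<Psi> ?LA B"
    if B: "B \<in> sets sphere_borel" "B \<subseteq> U {0<..}" for B
    using eq[OF bodies(4,2) U supp_pos(1) B] eq[OF bodies(3,1) U supp_pos(2) B] by simp
  have eq3: "\<Psi> ?MA B + \<Psi> A B = \<Psi> ?KA B + \<Psi> ?LA B"
    if B: "B \<in> sets sphere_borel" "B \<subseteq> U {..<0}" for B
    using eq[OF bodies(4,3) U supp_neg(1) B] eq[OF bodies(2,1) U supp_neg(2) B] by simp
  fix B :: "'a set"
  show "(\<Psi> ?MA + \<Psi> A) B = (\<Psi> ?KA + \<Psi> ?LA) B"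
  proof (cases "B \<in> sets sphere_borel")
    case True
    \<comment> \<open>The three open regions overlap, so the middle one is removed from the others
      to cut \<open>B\<close> into disjoint Borel pieces, each still inside one region.\<close>
    have B1: "B \<inter> U {-r<..<r} \<in> sets sphere_borel" "B \<inter> U {0<..} - U {-r<..<r} \<in> sets sphere_borel"
      "B \<inter> U {..<0} - U {-r<..<r} \<in> sets sphere_borel"
      using True U_sets by auto
    have split: "\<Psi> X B = \<Psi> X (B \<inter> U {-r<..<r}) + (\<Psi> X (B \<inter> U {0<..} - U {-r<..<r})
        + \<Psi> X (B \<inter> U {..<0} - U {-r<..<r}))"
      if "X \<in> convex_bodies" for X
    proof -
      have "B \<subseteq> sphere 0 1" using sets.sets_into_space[OF True] by (simp add: space_sphere_borel)
      then have B2: "B = B \<inter> U {-r<..<r} \<union> ((B \<inter> U {0<..} - U {-r<..<r}) \<union> (B \<inter> U {..<0} - U {-r<..<r}))"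
        using r by (auto simp: U_def)
      note add = complex_measure_Un[OF cm[OF that]]
      have "\<Psi> X B = \<Psi> X (B \<inter> U {-r<..<r})
          + \<Psi> X ((B \<inter> U {0<..} - U {-r<..<r}) \<union> (B \<inter> U {..<0} - U {-r<..<r}))"
        \<comment> \<open>\<open>B\<close> occurs on both sides of \<open>B2\<close>, so the
          equation is applied exactly once.\<close>
        by (rule trans[OF arg_cong[OF B2]], rule add[OF B1(1) sets.Un[OF B1(2,3)]]) auto
      also have "\<Psi> X ((B \<inter> U {0<..} - U {-r<..<r}) \<union> (B \<inter> U {..<0} - U {-r<..<r}))
          = \<Psi> X (B \<inter> U {0<..} - U {-r<..<r}) + \<Psi> X (B \<inter> U {..<0} - U {-r<..<r})"
        by (rule add[OF B1(2,3)]) (auto simp: U_def)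
      finally show ?thesis .
    qed
    let ?B1 = "B \<inter> U {-r<..<r}" and ?B2 = "B \<inter> U {0<..} - U {-r<..<r}"
      and ?B3 = "B \<inter> U {..<0} - U {-r<..<r}"
    have sub: "?B1 \<subseteq> U {-r<..<r}" "?B2 \<subseteq> U {0<..}" "?B3 \<subseteq> U {..<0}" by auto
    have "(\<Psi> ?MA + \<Psi> A) B = (\<Psi> ?MA ?B1 + \<Psi> A ?B1) + ((\<Psi> ?MA ?B2 + \<Psi> A ?B2) + (\<Psi> ?MA ?B3 + \<Psi> A ?B3))"
      by (simp add: split[OF bodies(4)] split[OF bodies(1)] add.assoc add.commute add.left_commute)
    also have "\<dots> = (\<Psi> ?KA + \<Psi> ?LA) B"
      unfolding eq1[OF B1(1) sub(1)] eq2[OF B1(2) sub(2)] eq3[OF B1(3) sub(3)]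
      by (simp add: split[OF bodies(2)] split[OF bodies(3)] add.assoc add.commute add.left_commute)
    finally show ?thesis .
  next
    case False
    then show ?thesis using bodies[THEN cm] by (simp add: complex_measures_def)
  qed
qed

section \<open>The limit as the radius tends to zero\<close>

theorem theorem3p1:
  fixes \<Psi> :: "(real ^ 'n) set \<Rightarrow> ((real ^ 'n) set \<Rightarrow> complex)"
  assumes "continuous_map (Metric_space.mtopology convex_bodies hausdorff_dist)
             weak_star_topology \<Psi>"
    and "locally_determined \<Psi>"
  shows "\<forall>K\<in>convex_bodies. \<forall>L\<in>convex_bodies. convex (K \<union> L) \<longrightarrow>
           \<Psi> (K \<union> L) + \<Psi> (K \<inter> L) = \<Psi> K + \<Psi> L"
proof (intro ballI impI)
  fix K L :: "(real ^ 'n) set"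
  assume K: "K \<in> convex_bodies" and L: "L \<in> convex_bodies" and KL: "convex (K \<union> L)"
  interpret Metric_space convex_bodies "hausdorff_dist :: (real ^ 'n) set \<Rightarrow> _"
    by (rule Metric_space_hausdorff_dist)
  \<comment> \<open>Continuity includes that values lie in the \<open>topspace\<close> of the
    target.\<close>
  have cm: "\<Psi> X \<in> complex_measures" if "X \<in> convex_bodies" for X
    using continuous_map_funspace[OF assms(1)] that by (auto simp: topspace_weak_star_topology)
  note I = Int_convex_bodies[OF K L KL]
  have M: "K \<union> L \<in> convex_bodies" using K L KL by (auto simp: convex_bodies_def)
  define r where "r n = inverse (real (Suc n))" for n
  have r: "0 < r n" for n by (simp add: r_def)
  have r0: "r \<longlonglongrightarrow> 0" unfolding r_def by (rule LIMSEQ_inverse_real_of_nat)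
  define A where "A n = parallel_body (K \<inter> L) (r n)" for n
  have A: "A n \<in> convex_bodies" for n
    unfolding A_def by (rule parallel_body_convex_bodies[OF I]) (use r in \<open>simp add: less_imp_le\<close>)
  have body: "convex hull (X \<union> A n) \<in> convex_bodies" if "X \<in> convex_bodies" for X n
    by (rule convex_hull_Un_convex_bodies[OF that A])
  have "limitin mtopology A (K \<inter> L) sequentially"
    by (rule limitin_parallel_body_squeeze[OF I A _ _ _ r0])
      (use r in \<open>auto simp: A_def less_imp_le parallel_body_superset[THEN subsetD]\<close>)
  \<comment> \<open>Used for \<open>K\<close>, \<open>L\<close> and \<open>K \<union> L\<close>. As
    \<open>X\<close> contains \<open>K \<inter> L\<close>, its parallel body contains
    \<open>A n\<close>; being convex, it contains the hull as well.\<close>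
  moreover have "limitin mtopology (\<lambda>n. convex hull (X \<union> A n)) X sequentially"
    if X: "X \<in> convex_bodies" "K \<inter> L \<subseteq> X" for X
  proof (rule limitin_parallel_body_squeeze[OF X(1) body[OF X(1)] _ _ _ r0])
    show "X \<subseteq> convex hull (X \<union> A n)" for n using hull_subset[of "X \<union> A n" convex] by auto
    show "convex hull (X \<union> A n) \<subseteq> parallel_body X (r n)" for n
      using parallel_body_convex_bodies[OF X(1), of "r n"] parallel_body_superset[of "r n" X]
        parallel_body_mono[OF X(2), of "r n"] r[of n]
      by (intro hull_minimal) (auto simp: A_def convex_bodies_def)
  qed (use r in \<open>simp add: less_imp_le\<close>)
  ultimately have lim: "limitin weak_star_topology (\<lambda>n. \<Psi> (A n)) (\<Psi> (K \<inter> L)) sequentially"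
    "X \<in> convex_bodies \<Longrightarrow> K \<inter> L \<subseteq> X \<Longrightarrow>
      limitin weak_star_topology (\<lambda>n. \<Psi> (convex hull (X \<union> A n))) (\<Psi> X) sequentially" for X
    using continuous_map_limit[OF assms(1), unfolded o_def] by (blast, blast)
  show "\<Psi> (K \<union> L) + \<Psi> (K \<inter> L) = \<Psi> K + \<Psi> L"
  proof (rule weak_star_limit_add_cong)
    show "\<Psi> (convex hull (K \<union> L \<union> A n)) + \<Psi> (A n)
        = \<Psi> (convex hull (K \<union> A n)) + \<Psi> (convex hull (L \<union> A n))" for n
      unfolding A_def by (rule locally_determined_perturbed_valuation[OF assms(2) cm K L KL r])
  qed (use lim cm body A K L M in auto)
qed

end
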